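(* Let $r>0$ and let $(X,\{R_i\}_{i=0}^4)$ be a $Q$-polynomial association scheme with Krein array $\{r^2-4,\ r^2-9,\ 10,\ 1;\ 1,\ 2,\ r^2-9,\ r^2-4\}$. Then $r=9$.
   Context: An association scheme $(X,\{R_i\}_{i=0}^D)$: a finite set $X$ with non-empty relations $R_i$ whose adjacency matrices $A_i$ satisfy $A_0=I$, $\sum A_i=J$, $A_i^\top=A_i$, $A_iA_j=\sum_k p_{ij}^kA_k$ with nonnegative integers $p_{ij}^k$; the algebra they span has primitive idempotents $E_0=\frac1{|X|}J,E_1,\dots,E_D$. Krein parameters $q_{ij}^k$ are defined by $E_i\circ E_j=\frac1{|X|}\sum_k q_{ij}^kE_k$ ($\circ$ the entrywise product). The scheme is $Q$-polynomial with respect to an ordering $E_0,\dots,E_D$ iff the matrix $(q_{1j}^k)_{k,j}$ is tridiagonal with nonzero sub- and superdiagonals; its Krein array is then $\{b_0^*,\ldots,b_{D-1}^*;c_1^*,\ldots,c_D^*\}$ where $b_i^*=q_{1,i+1}^i$ and $c_i^*=q_{1,i-1}^i$. *)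

theory Defs
  imports "HOL-Analysis.Analysis"
begin

text \<open>The point set \<open>X\<close> is the universe of a finite type \<open>'a\<close>; relations are indexed
  by \<open>0, \<dots>, D\<close>, and values at indices beyond \<open>D\<close> are irrelevant throughout.\<close>

definition adj_mat :: "('a::finite) rel \<Rightarrow> real^'a^'a" where
  "adj_mat S = (\<chi> x y. if (x, y) \<in> S then 1 else 0)"

definition all_ones :: "real^('a::finite)^'a" where
  "all_ones = (\<chi> x y. 1)"

definition association_scheme :: "nat \<Rightarrow> (nat \<Rightarrow> ('a::finite) rel) \<Rightarrow> bool" where
  "association_scheme D R \<longleftrightarrow>
     (\<forall>i\<le>D. R i \<noteq> {}) \<and>
     adj_mat (R 0) = mat 1 \<and>
     (\<Sum>i\<le>D. adj_mat (R i)) = all_ones \<and>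
     (\<forall>i\<le>D. transpose (adj_mat (R i)) = adj_mat (R i)) \<and>
     (\<exists>p :: nat \<Rightarrow> nat \<Rightarrow> nat \<Rightarrow> nat. \<forall>i\<le>D. \<forall>j\<le>D.
        adj_mat (R i) ** adj_mat (R j) = (\<Sum>k\<le>D. real (p i j k) *\<^sub>R adj_mat (R k)))"

definition bose_mesner :: "nat \<Rightarrow> (nat \<Rightarrow> ('a::finite) rel) \<Rightarrow> (real^'a^'a) set" where
  "bose_mesner D R = span ((\<lambda>i. adj_mat (R i)) ` {..D})"

definition idempotents :: "(real^'a^('a::finite)) set \<Rightarrow> (real^'a^'a) set" where
  "idempotents M = {e \<in> M. e ** e = e}"

text \<open>An idempotent is primitive if it is nonzero and not a sum of two nonzero orthogonal
  idempotents.\<close>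

definition primitive_idempotents :: "(real^'a^('a::finite)) set \<Rightarrow> (real^'a^'a) set" where
  "primitive_idempotents M = {e \<in> idempotents M. e \<noteq> 0 \<and>
     \<not> (\<exists>f \<in> idempotents M. \<exists>g \<in> idempotents M.
          f \<noteq> 0 \<and> g \<noteq> 0 \<and> f ** g = 0 \<and> g ** f = 0 \<and> e = f + g)}"

definition idempotent_ordering ::
    "nat \<Rightarrow> (nat \<Rightarrow> ('a::finite) rel) \<Rightarrow> (nat \<Rightarrow> real^'a^'a) \<Rightarrow> bool" where
  "idempotent_ordering D R E \<longleftrightarrow>
     bij_betw E {..D} (primitive_idempotents (bose_mesner D R)) \<and>
     E 0 = (1 / real CARD('a)) *\<^sub>R all_ones"

text \<open>\<open>q i j k\<close> stands for $q_{ij}^k$. The product \<open>*\<close> on \<open>real^'a^'a\<close> is the entrywise one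
  (the matrix product is \<open>**\<close>). Since the \<open>E k\<close> form a basis of the Bose--Mesner algebra, the
  equations determine \<open>q\<close> uniquely on indices up to \<open>D\<close>.\<close>

definition krein_parameters ::
    "nat \<Rightarrow> (nat \<Rightarrow> real^('a::finite)^'a) \<Rightarrow> (nat \<Rightarrow> nat \<Rightarrow> nat \<Rightarrow> real) \<Rightarrow> bool" where
  "krein_parameters D E q \<longleftrightarrow>
     (\<forall>i\<le>D. \<forall>j\<le>D. E i * E j = (1 / real CARD('a)) *\<^sub>R (\<Sum>k\<le>D. q i j k *\<^sub>R E k))"

text \<open>The matrix with entry \<open>q 1 j k\<close> in row \<open>k\<close> and column \<open>j\<close> is tridiagonal with nonzero
  sub- and superdiagonal.\<close>

definition Q_polynomial :: "nat \<Rightarrow> (nat \<Rightarrow> nat \<Rightarrow> nat \<Rightarrow> real) \<Rightarrow> bool" where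
  "Q_polynomial D q \<longleftrightarrow>
     (\<forall>k\<le>D. \<forall>j\<le>D.
        (j + 1 < k \<or> k + 1 < j \<longrightarrow> q 1 j k = 0) \<and>
        (k = j + 1 \<or> j = k + 1 \<longrightarrow> q 1 j k \<noteq> 0))"

definition krein_array :: "nat \<Rightarrow> (nat \<Rightarrow> nat \<Rightarrow> nat \<Rightarrow> real) \<Rightarrow> real list \<times> real list" where
  "krein_array D q =
     (map (\<lambda>i. q 1 (i + 1) i) [0..<D], map (\<lambda>i. q 1 (i - 1) i) [1..<D + 1])"

end

theory Submission
  imports Defs
begin

text \<open>
  Put \<open>Q\<^sub>i = |X| E\<^sub>i\<close>. The Krein array determines the entries: \<open>Q\<^sub>4\<close> takes the values \<open>5\<close> and \<open>-1\<close>,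
  and the relation \<open>Q\<^sub>4 = 5\<close> splits \<open>X\<close> into six fibres of size \<open>N = r\<^sup>2 (r\<^sup>2 - 1) / 12\<close>. Off the
  diagonal, \<open>Q\<^sub>1 = -4 \<plusminus> r\<close> inside a fibre and \<open>Q\<^sub>1 = 2 \<plusminus> r\<close> between distinct fibres. View \<open>Q\<^sub>1\<close>
  as the Gram matrix of vectors in dimension \<open>r\<^sup>2 - 4\<close>. Because \<open>q\<^sub>1\<^sub>1\<^sup>4 = q\<^sub>1\<^sub>1\<^sup>3 = 0\<close>, every fibre is a
  tight frame, and all six fibres have the same third moment tensor. Hence for \<open>x, y, z, u\<close> in
  four distinct fibres the sums over the fibres of \<open>x\<close> and of \<open>u\<close> of the product of the three
  signs attached to \<open>x, y, z\<close> differ by the explicit number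
  \<open>(r\<^sup>2 - 1) (6 \<plusminus> r) / (2 r)\<close>. These sums are integers (up to the term \<open>\<plusminus> r\<close> coming from \<open>x\<close>
  itself), and \<open>r\<close> is an integer because the analogous sum of a single sign is \<open>- 2 N / r\<close>.
  Therefore \<open>r\<close> divides \<open>6\<close>. As \<open>r > 3\<close>, this leaves \<open>r = 6\<close>, where counting the common
  positive neighbours of two points in a third fibre fails modulo \<open>4\<close>. So the hypotheses are
  contradictory, and the theorem holds vacuously.
\<close>

section \<open>The Bose--Mesner algebra\<close>

lemma bilinear_matrix_mult:
  "bilinear ((**) :: real^'n::finite^'m::finite \<Rightarrow> real^'p::finite^'n \<Rightarrow> real^'p^'m)"
  unfolding bilinear_def
  by (auto intro!: linearI simp: matrix_matrix_mult_def vec_eq_iff algebra_simps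
      sum.distrib sum_distrib_left)

lemmas matrix_mult_linear_simps =
  bilinear_ladd[OF bilinear_matrix_mult] bilinear_radd[OF bilinear_matrix_mult]
  bilinear_lsub[OF bilinear_matrix_mult] bilinear_rsub[OF bilinear_matrix_mult]
  bilinear_lmul[OF bilinear_matrix_mult] bilinear_rmul[OF bilinear_matrix_mult]

lemma symmetric_bose_mesner:
  assumes "association_scheme D R" and "A \<in> bose_mesner D R"
  shows "transpose A = A"
proof -
  have "linear (transpose :: real^'a^'a \<Rightarrow> real^'a^'a)"
    by (intro linearI) (simp_all add: transpose_def vec_eq_iff)
  then have "subspace {A :: real^'a^'a. transpose A = A}"
    by (auto simp: subspace_def linear_add linear_scale linear_0)
  moreover have "(\<lambda>i. adj_mat (R i)) ` {..D} \<subseteq> {A. transpose A = A}"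
    using assms(1) by (auto simp: association_scheme_def)
  ultimately show ?thesis
    using assms(2) span_minimal unfolding bose_mesner_def by blast
qed

text \<open>The intersection numbers settle products of two generators. For a fixed factor, the
  other factors whose product lies in the algebra form a subspace, so linearity extends this one
  factor at a time.\<close>

lemma matrix_mult_bose_mesner:
  assumes "association_scheme D R" and "A \<in> bose_mesner D R" and "B \<in> bose_mesner D R"
  shows "A ** B \<in> bose_mesner D R"
proof -
  let ?G = "(\<lambda>i. adj_mat (R i)) ` {..D}" and ?M = "bose_mesner D R"
  have M: "subspace ?M" by (simp add: bose_mesner_def)
  have base: "?G \<subseteq> ?M" by (simp add: bose_mesner_def span_superset)
  have gen: "A ** B \<in> ?M" if AB: "A \<in> ?G" "B \<in> ?G" for A B
  proof -
    obtain i j where ij: "i \<le> D" "A = adj_mat (R i)" "j \<le> D" "B = adj_mat (R j)"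
      using AB by blast
    obtain p :: "nat \<Rightarrow> nat \<Rightarrow> nat \<Rightarrow> nat" where
      "\<forall>i\<le>D. \<forall>j\<le>D. adj_mat (R i) ** adj_mat (R j) = (\<Sum>k\<le>D. real (p i j k) *\<^sub>R adj_mat (R k))"
      using assms(1) unfolding association_scheme_def by (elim conjE exE)
    then have "A ** B = (\<Sum>k\<le>D. real (p i j k) *\<^sub>R adj_mat (R k))"
      using ij by simp
    then show ?thesis
      using base by (auto intro!: subspace_sum[OF M] subspace_scale[OF M])
  qed
  have left: "A ** B \<in> ?M" if "A \<in> ?G" "B \<in> ?M" for A B
  proof -
    have "subspace {B. A ** B \<in> ?M}"
      using M by (auto simp: subspace_def matrix_mult_linear_simps)
    then show ?thesis
      using gen[OF that(1)] that(2) span_minimal[of ?G "{B. A ** B \<in> ?M}"]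
      unfolding bose_mesner_def by blast
  qed
  have "subspace {A. A ** B \<in> ?M}"
    using M by (auto simp: subspace_def matrix_mult_linear_simps)
  then show ?thesis
    using left assms(2,3) span_minimal[of ?G "{A. A ** B \<in> ?M}"]
    unfolding bose_mesner_def by blast
qed

lemma matrix_mult_commute_bose_mesner:
  assumes "association_scheme D R" and "A \<in> bose_mesner D R" and "B \<in> bose_mesner D R"
  shows "A ** B = B ** A"
proof -
  have "A ** B = transpose (A ** B)"
    using symmetric_bose_mesner[OF assms(1) matrix_mult_bose_mesner[OF assms]] by simp
  also have "\<dots> = B ** A"
    using symmetric_bose_mesner[OF assms(1)] assms(2,3) by (simp add: matrix_transpose_mul)
  finally show ?thesis .
qed

lemma mat_1_in_bose_mesner:
  assumes "association_scheme D R"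
  shows "mat 1 \<in> bose_mesner D R"
proof -
  have "adj_mat (R 0) \<in> bose_mesner D R"
    unfolding bose_mesner_def by (intro span_base) simp
  then show ?thesis using assms by (simp add: association_scheme_def)
qed

lemma diag_adj_mat:
  fixes R :: "nat \<Rightarrow> ('a::finite) rel"
  assumes "association_scheme D R" and "i \<le> D" and "i \<noteq> 0"
  shows "adj_mat (R i) $ x $ x = 0"
proof -
  have "(\<Sum>j\<le>D. adj_mat (R j)) $ x $ x = 1" and 0: "adj_mat (R 0) $ x $ x = 1"
    using assms(1) by (simp_all add: association_scheme_def all_ones_def mat_def)
  then have "1 = (\<Sum>j\<le>D. adj_mat (R j) $ x $ x)" by simp
  also have "\<dots> \<ge> (\<Sum>j\<in>{0, i}. adj_mat (R j) $ x $ x)"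
    using assms(2) by (intro sum_mono2) (auto simp: adj_mat_def)
  finally have "adj_mat (R i) $ x $ x \<le> 0" using assms(3) 0 by simp
  then show ?thesis by (simp add: adj_mat_def split: if_splits)
qed

lemma diag_bose_mesner:
  fixes R :: "nat \<Rightarrow> ('a::finite) rel"
  assumes "association_scheme D R" and "A \<in> bose_mesner D R"
  shows "A $ x $ x = A $ y $ y"
proof -
  have "subspace {A :: real^'a^'a. A $ x $ x = A $ y $ y}"
    by (simp add: subspace_def)
  moreover have "adj_mat (R i) $ x $ x = adj_mat (R i) $ y $ y" if "i \<le> D" for i
  proof (cases "i = 0")
    case True
    then show ?thesis using assms(1) by (simp add: association_scheme_def mat_def)
  next
    case False
    then show ?thesis using diag_adj_mat[OF assms(1) that] by simp
  qed
  then have "(\<lambda>i. adj_mat (R i)) ` {..D} \<subseteq> {A. A $ x $ x = A $ y $ y}" by auto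
  ultimately show ?thesis
    using assms(2) span_minimal unfolding bose_mesner_def by blast
qed

text \<open>If \<open>e ** f\<close> is nonzero, then \<open>e ** f\<close> and
  \<open>e - e ** f\<close> split \<open>e\<close> orthogonally, so primitivity forces
  \<open>e ** f = e\<close>. The same with the roles exchanged gives \<open>f ** e = f\<close>, and
  commutativity yields \<open>e = f\<close>.\<close>

lemma primitive_idempotents_orthogonal:
  assumes "association_scheme D R"
    and "e \<in> primitive_idempotents (bose_mesner D R)"
    and "f \<in> primitive_idempotents (bose_mesner D R)"
    and "e \<noteq> f"
  shows "e ** f = 0"
proof (rule ccontr)
  assume ne: "e ** f \<noteq> 0"
  let ?M = "bose_mesner D R"
  have absorb: "e ** f = e"
    if e: "e \<in> primitive_idempotents ?M" and f: "f \<in> primitive_idempotents ?M"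
      and ne: "e ** f \<noteq> 0" for e f
  proof (rule ccontr)
    assume *: "e ** f \<noteq> e"
    have eM: "e \<in> ?M" "e ** e = e" and fM: "f \<in> ?M" "f ** f = f"
      using e f by (auto simp: primitive_idempotents_def idempotents_def)
    have com: "f ** e = e ** f" by (rule matrix_mult_commute_bose_mesner[OF assms(1) fM(1) eM(1)])
    have efM: "e ** f \<in> ?M" by (rule matrix_mult_bose_mesner[OF assms(1) eM(1) fM(1)])
    have dM: "e - e ** f \<in> ?M" using eM(1) efM by (simp add: bose_mesner_def span_diff)
    have i2: "e ** (e ** f) = e ** f" by (simp add: matrix_mul_assoc eM)
    have i3: "(e ** f) ** e = e ** f"
      using i2 by (simp add: matrix_mul_assoc[symmetric] com)
    have i1: "(e ** f) ** (e ** f) = e ** f"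
    proof -
      have "(e ** f) ** (e ** f) = ((e ** f) ** e) ** f" by (simp add: matrix_mul_assoc)
      also have "\<dots> = e ** (f ** f)" unfolding i3 by (simp add: matrix_mul_assoc)
      finally show ?thesis by (simp add: fM)
    qed
    have "e ** f \<in> idempotents ?M" "e - e ** f \<in> idempotents ?M"
      using efM dM i1 i2 i3 eM(2) by (auto simp: idempotents_def matrix_mult_linear_simps)
    moreover have "(e ** f) ** (e - e ** f) = 0" "(e - e ** f) ** (e ** f) = 0"
      using i1 i2 i3 by (auto simp: matrix_mult_linear_simps)
    moreover have "e = e ** f + (e - e ** f)" "e - e ** f \<noteq> 0" using * by auto
    ultimately show False using e ne unfolding primitive_idempotents_def by blast
  qed
  have "f ** e = e ** f"
    using assms by (intro matrix_mult_commute_bose_mesner[OF assms(1)])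
      (auto simp: primitive_idempotents_def idempotents_def)
  then show False using absorb[OF assms(2,3)] absorb[OF assms(3,2)] ne assms(4) by simp
qed

text \<open>Orthogonality makes the \<open>D + 1\<close> matrices \<open>E i\<close> independent,
  and the algebra is spanned by \<open>D + 1\<close> matrices, so they form a basis. The identity
  has all coefficients 1 in it.\<close>

lemma
  assumes "association_scheme D R" and "idempotent_ordering D R E"
  shows idempotent_ordering_mult:
      "\<And>i j. i \<le> D \<Longrightarrow> j \<le> D \<Longrightarrow> E i ** E j = (if i = j then E i else 0)"
    and idempotent_ordering_nonzero: "\<And>i. i \<le> D \<Longrightarrow> E i \<noteq> 0"
    and idempotent_ordering_in: "\<And>i. i \<le> D \<Longrightarrow> E i \<in> bose_mesner D R"
    and idempotent_ordering_sum: "(\<Sum>i\<le>D. E i) = mat 1"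
proof -
  let ?M = "bose_mesner D R"
  have bij: "bij_betw E {..D} (primitive_idempotents ?M)"
    using assms(2) by (simp add: idempotent_ordering_def)
  then have prim: "E i \<in> primitive_idempotents ?M" if "i \<le> D" for i
    using that by (auto dest: bij_betwE)
  show nz: "E i \<noteq> 0" and inM: "E i \<in> ?M" if "i \<le> D" for i
    using prim[OF that] by (auto simp: primitive_idempotents_def idempotents_def)
  show mult: "E i ** E j = (if i = j then E i else 0)" if "i \<le> D" "j \<le> D" for i j
  proof (cases "i = j")
    case True
    then show ?thesis
      using prim[OF that(1)] by (auto simp: primitive_idempotents_def idempotents_def)
  next
    case False
    then have "E i \<noteq> E j" using bij that by (auto simp: bij_betw_def inj_on_def)
    then show ?thesis
      using primitive_idempotents_orthogonal[OF assms(1) prim prim] that False by simp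
  qed
  have inj: "inj_on E {..D}" using bij by (simp add: bij_betw_def)
  \<comment> \<open>Multiplication by \<open>E j\<close> extracts the \<open>j\<close>-th
    coefficient; this serves both independence and the expansion of \<open>mat 1\<close>.\<close>
  have coeff: "(\<Sum>i\<le>D. c i *\<^sub>R E i) ** E j = c j *\<^sub>R E j" if "j \<le> D" for c j
  proof -
    have "(\<Sum>i\<le>D. c i *\<^sub>R E i) ** E j = (\<Sum>i\<le>D. (c i *\<^sub>R E i) ** E j)"
      by (simp add: linear_sum[of "\<lambda>A. A ** E j"] bilinear_matrix_mult[unfolded bilinear_def])
    also have "\<dots> = (\<Sum>i\<le>D. if i = j then c j *\<^sub>R E j else 0)"
      using that by (intro sum.cong) (auto simp: mult matrix_mult_linear_simps)
    finally show ?thesis using that by simp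
  qed
  have "independent (E ` {..D})"
  proof (rule independent_if_scalars_zero)
    fix f e assume f: "(\<Sum>x\<in>E ` {..D}. f x *\<^sub>R x) = 0" and "e \<in> E ` {..D}"
    then obtain j where j: "j \<le> D" "e = E j" by auto
    have "(\<Sum>i\<le>D. f (E i) *\<^sub>R E i) = 0" using f inj by (simp add: sum.reindex)
    then have "f (E j) *\<^sub>R E j = 0" using coeff[OF j(1), of "\<lambda>i. f (E i)"] by simp
    then show "f e = 0" using nz j by simp
  qed simp
  moreover have "dim ?M \<le> card (E ` {..D})"
  proof -
    have "dim ?M \<le> card ((\<lambda>i. adj_mat (R i)) ` {..D})"
      unfolding bose_mesner_def by (intro dim_le_card) auto
    also have "\<dots> \<le> Suc D" using card_image_le[of "{..D}"] by simp
    finally show ?thesis using inj by (simp add: card_image)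
  qed
  ultimately have "?M \<subseteq> span (E ` {..D})"
    using inM by (intro card_ge_dim_independent) auto
  then have "mat 1 \<in> span (E ` {..D})" using mat_1_in_bose_mesner[OF assms(1)] by blast
  then obtain c where "mat 1 = (\<Sum>x\<in>E ` {..D}. c x *\<^sub>R x)"
    by (auto simp: span_finite)
  then have c: "mat 1 = (\<Sum>i\<le>D. c (E i) *\<^sub>R E i)" using inj by (simp add: sum.reindex)
  have "c (E j) *\<^sub>R E j = 1 *\<^sub>R E j" if "j \<le> D" for j
    using coeff[OF that, of "\<lambda>i. c (E i)"] unfolding c[symmetric] by simp
  then have "(\<Sum>i\<le>D. c (E i) *\<^sub>R E i) = (\<Sum>i\<le>D. E i)" by simp
  then show "(\<Sum>i\<le>D. E i) = mat 1" using c by simp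
qed

section \<open>Entrywise form of the Krein equations\<close>

text \<open>In the application \<open>Q i\<close> is \<open>CARD('a) *\<^sub>R E i\<close>, so that the factor \<open>1 / CARD('a)\<close> disappears
  from the Krein equations, and \<open>m i\<close> is the rank of \<open>E i\<close>.\<close>

locale krein_system =
  fixes D :: nat
    and Q :: "nat \<Rightarrow> 'a::finite \<Rightarrow> 'a \<Rightarrow> real"
    and q :: "nat \<Rightarrow> nat \<Rightarrow> nat \<Rightarrow> real"
    and m :: "nat \<Rightarrow> real"
    and n :: real
  assumes n_card: "n = real CARD('a)"
    and Q_sym: "i \<le> D \<Longrightarrow> Q i x y = Q i y x"
    and Q_orth: "i \<le> D \<Longrightarrow> j \<le> D \<Longrightarrow>
      (\<Sum>w\<in>UNIV. Q i x w * Q j y w) = (if i = j then n * Q i x y else 0)"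
    and Q_0: "Q 0 x y = 1"
    and Q_total: "(\<Sum>i\<le>D. Q i x y) = (if x = y then n else 0)"
    and Q_diag: "i \<le> D \<Longrightarrow> Q i x x = m i"
    and Q_nonzero: "i \<le> D \<Longrightarrow> \<exists>x y. Q i x y \<noteq> 0"
    and Q_krein: "i \<le> D \<Longrightarrow> j \<le> D \<Longrightarrow> Q i x y * Q j x y = (\<Sum>k\<le>D. q i j k * Q k x y)"
begin

lemma n_pos: "n > 0"
  by (simp add: n_card)

lemma m_pos:
  assumes "i \<le> D"
  shows "m i > 0"
proof -
  obtain x y where xy: "Q i x y \<noteq> 0" using Q_nonzero[OF assms] by blast
  then have "0 < Q i x y * Q i x y" by (metis not_real_square_gt_zero)
  also have "\<dots> \<le> (\<Sum>w\<in>UNIV. Q i x w * Q i x w)"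
    by (rule member_le_sum) auto
  also have "\<dots> = n * m i" using Q_orth[OF assms assms, of x x] Q_diag[OF assms] by simp
  finally show ?thesis using n_pos by (simp add: zero_less_mult_iff)
qed

text \<open>Expanding \<open>Q i * Q j\<close> by the Krein equation, orthogonality keeps only the
  term \<open>l = k\<close>. The left side is symmetric in \<open>i, j, k\<close>, which is the
  source of \<open>krein_symmetry\<close>.\<close>

lemma triple_sum:
  assumes "i \<le> D" "j \<le> D" "k \<le> D"
  shows "(\<Sum>x\<in>UNIV. \<Sum>y\<in>UNIV. Q i x y * Q j x y * Q k x y) = n\<^sup>2 * (q i j k * m k)"
proof -
  have "(\<Sum>y\<in>UNIV. Q i x y * Q j x y * Q k x y) = n * (q i j k * m k)" for x
  proof -
    have "(\<Sum>y\<in>UNIV. Q i x y * Q j x y * Q k x y)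
        = (\<Sum>y\<in>UNIV. \<Sum>l\<le>D. q i j l * (Q l x y * Q k x y))"
      using assms by (simp add: Q_krein sum_distrib_right mult.assoc)
    also have "\<dots> = (\<Sum>l\<le>D. q i j l * (\<Sum>y\<in>UNIV. Q l x y * Q k x y))"
      by (subst sum.swap) (simp add: sum_distrib_left)
    also have "\<dots> = (\<Sum>l\<le>D. if l = k then n * (q i j k * m k) else 0)"
      using assms by (intro sum.cong) (auto simp: Q_orth Q_diag)
    finally show ?thesis using assms by simp
  qed
  then show ?thesis by (simp add: power2_eq_square n_card)
qed

lemma krein_symmetry:
  assumes "i \<le> D" "j \<le> D" "k \<le> D"
  shows "q i j k * m k = q i k j * m j"
proof -
  have "n\<^sup>2 * (q i j k * m k) = n\<^sup>2 * (q i k j * m j)"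
    unfolding triple_sum[OF assms, symmetric] triple_sum[OF assms(1,3,2), symmetric]
    by (simp add: mult.commute mult.left_commute)
  then show ?thesis using n_pos by simp
qed

lemma krein_diag:
  assumes "i \<le> D" "j \<le> D"
  shows "m i * m j = (\<Sum>k\<le>D. q i j k * m k)"
  using Q_krein[OF assms, of undefined undefined] assms by (simp add: Q_diag)

text \<open>The sum over all \<open>x, y, z\<close> of the squares of the left-hand side is a multiple of
  \<open>q i j k\<close>.\<close>

lemma triple_product_vanishes:
  assumes "i \<le> D" "j \<le> D" "k \<le> D" "q i j k = 0"
  shows "(\<Sum>w\<in>UNIV. Q i x w * Q j y w * Q k z w) = 0"
proof -
  let ?S = "\<lambda>x y z. \<Sum>w\<in>UNIV. Q i x w * Q j y w * Q k z w"
  have S: "?S x y z = (\<Sum>w\<in>UNIV. Q i w x * Q j w y * Q k w z)" for x y z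
    using Q_sym[OF assms(1), of x] Q_sym[OF assms(2), of y] Q_sym[OF assms(3), of z] by metis
  have swap: "(\<Sum>x\<in>UNIV. \<Sum>y\<in>UNIV. \<Sum>z\<in>UNIV. \<Sum>w\<in>UNIV. g x y z w)
      = (\<Sum>w\<in>UNIV. \<Sum>x\<in>UNIV. \<Sum>y\<in>UNIV. \<Sum>z\<in>UNIV. g x y z w)"
    for g :: "'a \<Rightarrow> 'a \<Rightarrow> 'a \<Rightarrow> 'a \<Rightarrow> real"
  proof -
    have "(\<Sum>x\<in>UNIV. \<Sum>y\<in>UNIV. \<Sum>z\<in>UNIV. \<Sum>w\<in>UNIV. g x y z w)
        = (\<Sum>x\<in>UNIV. \<Sum>y\<in>UNIV. \<Sum>w\<in>UNIV. \<Sum>z\<in>UNIV. g x y z w)"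
      by (rule sum.cong[OF refl], rule sum.cong[OF refl], rule sum.swap)
    also have "\<dots> = (\<Sum>x\<in>UNIV. \<Sum>w\<in>UNIV. \<Sum>y\<in>UNIV. \<Sum>z\<in>UNIV. g x y z w)"
      by (rule sum.cong[OF refl], rule sum.swap)
    also have "\<dots> = (\<Sum>w\<in>UNIV. \<Sum>x\<in>UNIV. \<Sum>y\<in>UNIV. \<Sum>z\<in>UNIV. g x y z w)"
      by (rule sum.swap)
    finally show ?thesis .
  qed
  have prod3: "sum a UNIV * sum b UNIV * sum c UNIV
      = (\<Sum>x\<in>UNIV. \<Sum>y\<in>UNIV. \<Sum>z\<in>UNIV. a x * b y * c z)" for a b c :: "'a \<Rightarrow> real"
  proof -
    have "sum a UNIV * sum b UNIV * sum c UNIV = (\<Sum>x\<in>UNIV. a x * (sum b UNIV * sum c UNIV))"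
      by (simp add: sum_distrib_right mult.assoc)
    also have "\<dots> = (\<Sum>x\<in>UNIV. a x * (\<Sum>y\<in>UNIV. \<Sum>z\<in>UNIV. b y * c z))"
      by (simp only: sum_product)
    finally show ?thesis by (simp add: sum_distrib_left mult.assoc)
  qed
  \<comment> \<open>A second variable \<open>w'\<close> expands the square. Summing over
    \<open>x, y, z\<close> first, orthogonality turns the three factors into \<open>n\<close> times
    entries at \<open>(w, w')\<close>, and \<open>triple_sum\<close> applies.\<close>
  have "(\<Sum>x\<in>UNIV. \<Sum>y\<in>UNIV. \<Sum>z\<in>UNIV. (?S x y z)\<^sup>2)
      = (\<Sum>x\<in>UNIV. \<Sum>y\<in>UNIV. \<Sum>z\<in>UNIV. \<Sum>w\<in>UNIV. \<Sum>w'\<in>UNIV.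
          (Q i w x * Q i w' x) * (Q j w y * Q j w' y) * (Q k w z * Q k w' z))"
    unfolding S by (simp add: power2_eq_square sum_product mult_ac)
  also have "\<dots> = (\<Sum>w\<in>UNIV. \<Sum>w'\<in>UNIV. \<Sum>x\<in>UNIV. \<Sum>y\<in>UNIV. \<Sum>z\<in>UNIV.
          (Q i w x * Q i w' x) * (Q j w y * Q j w' y) * (Q k w z * Q k w' z))"
    by (subst swap, rule sum.cong[OF refl], rule swap)
  also have "\<dots> = (\<Sum>w\<in>UNIV. \<Sum>w'\<in>UNIV.
      (\<Sum>x\<in>UNIV. Q i w x * Q i w' x) * (\<Sum>y\<in>UNIV. Q j w y * Q j w' y)
        * (\<Sum>z\<in>UNIV. Q k w z * Q k w' z))"
    by (simp only: prod3)
  also have "\<dots> = (\<Sum>w\<in>UNIV. \<Sum>w'\<in>UNIV. n ^ 3 * (Q i w w' * Q j w w' * Q k w w'))"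
    using assms by (simp add: Q_orth power3_eq_cube mult_ac)
  also have "\<dots> = n ^ 3 * (n\<^sup>2 * (q i j k * m k))"
    using assms triple_sum[OF assms(1-3)] by (simp add: sum_distrib_left[symmetric])
  also have "\<dots> = 0" using assms by simp
  finally have "\<forall>x y z. (?S x y z)\<^sup>2 = 0"
    by (simp add: sum_nonneg_eq_0_iff sum_nonneg)
  then show ?thesis by simp
qed

end

section \<open>Entries and fibres\<close>

lemma sum_atMost_4: "(\<Sum>i\<le>4. f i) = f 0 + f 1 + f 2 + f 3 + f 4" for f :: "nat \<Rightarrow> real"
  by (simp add: atMost_nat_numeral atMost_Suc)

locale krein_array_r = krein_system 4 Q q m n
  for Q :: "nat \<Rightarrow> 'a::finite \<Rightarrow> 'a \<Rightarrow> real" and q m n +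
  fixes r :: real
  assumes r_pos: "r > 0"
    and tridiag: "j \<le> 4 \<Longrightarrow> k \<le> 4 \<Longrightarrow> j + 1 < k \<or> k + 1 < j \<Longrightarrow> q 1 j k = 0"
    and b_star: "q 1 1 0 = r\<^sup>2 - 4" "q 1 2 1 = r\<^sup>2 - 9" "q 1 3 2 = 10" "q 1 4 3 = 1"
    and c_star: "q 1 0 1 = 1" "q 1 1 2 = 2" "q 1 2 3 = r\<^sup>2 - 9" "q 1 3 4 = r\<^sup>2 - 4"
    and b1_nonzero: "r\<^sup>2 \<noteq> 9"
begin

text \<open>Krein symmetry between neighbouring indices yields each multiplicity from the preceding
  one.\<close>

lemma m_eqs: "m 0 = 1" "m 1 = r\<^sup>2 - 4" "2 * m 2 = (r\<^sup>2 - 4) * (r\<^sup>2 - 9)"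
    "m 3 = 5 * (r\<^sup>2 - 4)" "m 4 = 5"
proof -
  show 0: "m 0 = 1" using Q_diag[of 0] Q_0 by simp
  have "q 1 1 0 * m 0 = q 1 0 1 * m 1" by (rule krein_symmetry) simp_all
  then show 1: "m 1 = r\<^sup>2 - 4" unfolding 0 b_star c_star by simp
  have "q 1 1 2 * m 2 = q 1 2 1 * m 1" by (rule krein_symmetry) simp_all
  then show 2: "2 * m 2 = (r\<^sup>2 - 4) * (r\<^sup>2 - 9)" unfolding 1 b_star c_star by simp
  have "q 1 2 3 * m 3 = q 1 3 2 * m 2" by (rule krein_symmetry) simp_all
  then have "(r\<^sup>2 - 9) * m 3 = (r\<^sup>2 - 9) * (5 * (r\<^sup>2 - 4))"
    unfolding b_star c_star using 2 by algebra
  then show 3: "m 3 = 5 * (r\<^sup>2 - 4)" using b1_nonzero by simp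
  have "q 1 3 4 * m 4 = q 1 4 3 * m 3" by (rule krein_symmetry) simp_all
  then have "(r\<^sup>2 - 4) * m 4 = (r\<^sup>2 - 4) * 5" unfolding 3 b_star c_star by simp
  moreover have "r\<^sup>2 - 4 \<noteq> 0" using m_pos[of 1] unfolding 1 by simp
  ultimately show "m 4 = 5" by (metis mult_left_cancel)
qed

lemma r_gt_3: "r > 3"
proof -
  have "r\<^sup>2 - 4 > 0" using m_eqs(2) m_pos[of 1] by simp
  moreover have "(r\<^sup>2 - 4) * (r\<^sup>2 - 9) > 0" using m_eqs(3) m_pos[of 2] by simp
  ultimately have "3\<^sup>2 < r\<^sup>2" by (simp add: zero_less_mult_iff)
  then show ?thesis by (rule power2_less_imp_less) (use r_pos in simp)
qed

lemma n_eq: "2 * n = r\<^sup>2 * (r\<^sup>2 - 1)"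
proof -
  have "(\<Sum>i\<le>4. m i) = n" using Q_total[of undefined undefined] by (simp add: Q_diag)
  then show ?thesis using m_eqs by (simp add: sum_atMost_4 algebra_simps)
qed

text \<open>The array gives only the off-diagonal parameters. The diagonal ones follow from
  \<open>krein_diag\<close>, where tridiagonality leaves at most three terms.\<close>

lemma a_star: "q 1 0 0 = 0" "q 1 1 1 = 4" "q 1 2 2 = r\<^sup>2 - 16" "q 1 3 3 = 4" "q 1 4 4 = 0"
proof -
  note s = sum_atMost_4 tridiag b_star c_star m_eqs(1)
  have pos: "m 1 \<noteq> 0" "m 2 \<noteq> 0" "m 3 \<noteq> 0"
    using m_pos[of 1] m_pos[of 2] m_pos[of 3] by auto
  show "q 1 0 0 = 0" using krein_diag[of 1 0] by (simp add: s del: One_nat_def)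
  have "m 1 * m 1 = r\<^sup>2 - 4 + q 1 1 1 * m 1 + 2 * m 2"
    using krein_diag[of 1 1] by (simp add: s del: One_nat_def)
  then have "m 1 * q 1 1 1 = m 1 * 4"
    using m_eqs by algebra
  then show "q 1 1 1 = 4" using pos by simp
  have "m 1 * m 2 = (r\<^sup>2 - 9) * m 1 + q 1 2 2 * m 2 + (r\<^sup>2 - 9) * m 3"
    using krein_diag[of 1 2] by (simp add: s del: One_nat_def)
  then have "m 2 * q 1 2 2 = m 2 * (r\<^sup>2 - 16)" using m_eqs by algebra
  then show "q 1 2 2 = r\<^sup>2 - 16" using pos by simp
  have "m 1 * m 3 = 10 * m 2 + q 1 3 3 * m 3 + (r\<^sup>2 - 4) * m 4"
    using krein_diag[of 1 3] by (simp add: s del: One_nat_def)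
  then have "m 3 * q 1 3 3 = m 3 * 4" using m_eqs by algebra
  then show "q 1 3 3 = 4" using pos by simp
  have "m 1 * m 4 = m 3 + q 1 4 4 * m 4"
    using krein_diag[of 1 4] by (simp add: s del: One_nat_def)
  then show "q 1 4 4 = 0" by (simp add: m_eqs del: One_nat_def)
qed

lemma entry_eqs:
  shows "(Q 1 x y)\<^sup>2 = r\<^sup>2 - 4 + 4 * Q 1 x y + 2 * Q 2 x y"
    and "Q 1 x y * Q 2 x y = (r\<^sup>2 - 9) * Q 1 x y + (r\<^sup>2 - 16) * Q 2 x y + (r\<^sup>2 - 9) * Q 3 x y"
    and "Q 1 x y * Q 3 x y = 10 * Q 2 x y + 4 * Q 3 x y + (r\<^sup>2 - 4) * Q 4 x y"
    and "Q 1 x y * Q 4 x y = Q 3 x y"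
proof -
  note s = sum_atMost_4 tridiag b_star c_star a_star Q_0
  show "(Q 1 x y)\<^sup>2 = r\<^sup>2 - 4 + 4 * Q 1 x y + 2 * Q 2 x y"
    using Q_krein[of 1 1 x y] by (simp add: s power2_eq_square[of "Q _ _ _"] del: One_nat_def)
  show "Q 1 x y * Q 2 x y = (r\<^sup>2 - 9) * Q 1 x y + (r\<^sup>2 - 16) * Q 2 x y + (r\<^sup>2 - 9) * Q 3 x y"
    using Q_krein[of 1 2 x y] by (simp add: s del: One_nat_def)
  show "Q 1 x y * Q 3 x y = 10 * Q 2 x y + 4 * Q 3 x y + (r\<^sup>2 - 4) * Q 4 x y"
    using Q_krein[of 1 3 x y] by (simp add: s del: One_nat_def)
  show "Q 1 x y * Q 4 x y = Q 3 x y"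
    using Q_krein[of 1 4 x y] by (simp add: s del: One_nat_def)
qed

text \<open>Eliminating \<open>Q 2\<close> and \<open>Q 3\<close> from the three-term recurrence
  leaves polynomial equations in \<open>Q 1 x y\<close> and \<open>Q 4 x y\<close>: first
  \<open>h * (Q 4 x y - 5) = 0\<close>, then a quadratic or a cubic for
  \<open>Q 1 x y\<close>.\<close>

lemma entry_cases:
  obtains "Q 4 x y = -1" "Q 1 x y = 2 + r \<or> Q 1 x y = 2 - r"
  | "Q 4 x y = 5" "x \<noteq> y" "Q 1 x y = -4 + r \<or> Q 1 x y = -4 - r"
  | "Q 4 x y = 5" "x = y" "Q 1 x y = r\<^sup>2 - 4"
proof -
  let ?v = "Q 1 x y"
  define h where "h = 2 * Q 2 x y"
  have h: "h = ?v\<^sup>2 - 4 * ?v - (r\<^sup>2 - 4)" using entry_eqs(1)[of x y] by (simp add: h_def)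
  have q3: "Q 3 x y = ?v * Q 4 x y" using entry_eqs(4) by simp
  have "h * (Q 4 x y - 5) = 0"
    using entry_eqs(3)[of x y] q3 h h_def by algebra
  then consider "h = 0" | "Q 4 x y = 5" by auto
  then show thesis
  proof cases
    case 1
    then have "(?v - (2 + r)) * (?v - (2 - r)) = 0"
      using h by algebra
    then have v: "?v = 2 + r \<or> ?v = 2 - r" by auto
    then have "?v \<noteq> 0" using r_gt_3 by auto
    have "(r\<^sup>2 - 9) * ?v * (1 + Q 4 x y) = 0"
      using entry_eqs(2)[of x y] 1 q3 h_def by algebra
    then have "Q 4 x y = -1" using \<open>?v \<noteq> 0\<close> b1_nonzero by auto
    then show ?thesis using v that(1) by blast
  next
    case 2
    have "?v * h = 12 * (r\<^sup>2 - 9) * ?v + (r\<^sup>2 - 16) * h"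
      using entry_eqs(2)[of x y] 2 q3 h_def by algebra
    then have "(?v - (r\<^sup>2 - 4)) * ((?v - (-4 + r)) * (?v - (-4 - r))) = 0"
      using h by algebra
    then consider "?v = r\<^sup>2 - 4" | "?v = -4 + r \<or> ?v = -4 - r" by auto
    then show ?thesis
    proof cases
      case v: 1
      \<comment> \<open>Here all \<open>Q i x y\<close> equal their diagonal values, so they add up
        to \<open>n\<close>; off the diagonal the total is 0.\<close>
      have "2 * Q 2 x y = 2 * m 2"
        using h v m_eqs(3) h_def by algebra
      then have "(\<Sum>i\<le>4. Q i x y) = (\<Sum>i\<le>4. m i)"
        using v q3 2 m_eqs by (simp add: sum_atMost_4 Q_0)
      moreover have "(\<Sum>i\<le>4. m i) = n" using Q_total[of x x] by (simp add: Q_diag)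
      ultimately have "x = y" using Q_total[of x y] n_pos by (auto split: if_splits)
      then show ?thesis using that(3) 2 v by blast
    next
      case v: 2
      have "?v \<noteq> r\<^sup>2 - 4"
      proof
        assume "?v = r\<^sup>2 - 4"
        then have "r\<^sup>2 = r \<or> r\<^sup>2 = - r" using v by auto
        then have "r * (r - 1) = 0 \<or> r * (r + 1) = 0" by (auto simp: power2_eq_square algebra_simps)
        then show False using r_gt_3 by auto
      qed
      then have "x \<noteq> y" using Q_diag[of 1 x] m_eqs(2) by auto
      then show ?thesis using that(2) 2 v by blast
    qed
  qed
qed

section \<open>Fibres and the moments of \<open>Q 1\<close> over a fibre\<close>

definition fib :: "'a \<Rightarrow> 'a set" where
  "fib u = {w. Q 4 u w = 5}"

text \<open>The sign in \<open>Q 1 x w = 2 \<plusminus> r\<close> (distinct fibres) or \<open>Q 1 x w = -4 \<plusminus> r\<close> (same fibre); the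
  value \<open>eps x x\<close> is meaningless and never used.\<close>

definition eps :: "'a \<Rightarrow> 'a \<Rightarrow> int" where
  "eps x w = (if Q 1 x w > (if Q 4 x w = 5 then -4 else 2) then 1 else -1)"

lemma eps_cases: "eps x w = 1 \<or> eps x w = -1"
  by (simp add: eps_def)

lemma Q4_cases: "Q 4 x y = 5 \<or> Q 4 x y = -1"
  by (cases rule: entry_cases[of x y]) auto

lemma Q1_eps_outside:
  assumes "Q 4 x w = -1"
  shows "Q 1 x w = 2 + r * eps x w"
  using assms r_pos by (cases rule: entry_cases[of x w]) (auto simp: eps_def)

lemma Q1_eps_inside:
  assumes "Q 4 x w = 5" "x \<noteq> w"
  shows "Q 1 x w = -4 + r * eps x w"
  using assms r_pos by (cases rule: entry_cases[of x w]) (auto simp: eps_def)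

text \<open>Rows of \<open>Q 4\<close> have squared norm \<open>5 * n\<close> and inner products
  \<open>n * Q 4 x y\<close>, so the value 5 is the equality case of Cauchy-Schwarz.\<close>

lemma Q4_row_eq:
  assumes "Q 4 x y = 5"
  shows "Q 4 x w = Q 4 y w"
proof -
  have "(\<Sum>w\<in>UNIV. (Q 4 x w - Q 4 y w)\<^sup>2)
      = (\<Sum>w\<in>UNIV. Q 4 x w * Q 4 x w) + (\<Sum>w\<in>UNIV. Q 4 y w * Q 4 y w)
        - 2 * (\<Sum>w\<in>UNIV. Q 4 x w * Q 4 y w)"
    by (simp add: power2_eq_square algebra_simps sum.distrib sum_subtractf sum_distrib_left)
  also have "\<dots> = 0" using assms by (simp add: Q_orth Q_diag m_eqs)
  finally have "(Q 4 x w - Q 4 y w)\<^sup>2 = 0" by (simp add: sum_nonneg_eq_0_iff)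
  then show ?thesis by simp
qed

lemma Q4_fib:
  assumes "w \<in> fib u"
  shows "Q 4 x w = Q 4 x u"
proof -
  have "Q 4 u x = Q 4 w x" by (rule Q4_row_eq) (use assms in \<open>simp add: fib_def\<close>)
  then show ?thesis using Q_sym[of 4 x w] Q_sym[of 4 x u] by simp
qed

text \<open>\<open>1 + Q 4 u w\<close> is six times the indicator of the fibre. Fibre sums thus
  become full sums, open to orthogonality and vanishing Krein parameters.\<close>

lemma sum_fib: "6 * (\<Sum>w\<in>fib u. f w) = (\<Sum>w\<in>UNIV. f w) + (\<Sum>w\<in>UNIV. f w * Q 4 u w)"
proof -
  have "6 * (\<Sum>w\<in>fib u. f w) = (\<Sum>w\<in>UNIV. if Q 4 u w = 5 then 6 * f w else 0)"
    by (simp add: fib_def sum_distrib_left sum.If_cases)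
  also have "\<dots> = (\<Sum>w\<in>UNIV. f w + f w * Q 4 u w)"
  proof (rule sum.cong[OF refl])
    fix w show "(if Q 4 u w = 5 then 6 * f w else 0) = f w + f w * Q 4 u w"
      using Q4_cases[of u w] by auto
  qed
  finally show ?thesis by (simp add: sum.distrib)
qed

lemma card_fib: "6 * real (card (fib u)) = n"
proof -
  have "(\<Sum>w\<in>UNIV. Q 4 u w) = 0" using Q_orth[of 4 0 u u] by (simp add: Q_0)
  then show ?thesis using sum_fib[of "\<lambda>_. 1" u] n_card by simp
qed

lemma sum_fib_1: "(\<Sum>w\<in>fib u. Q 1 x w) = 0"
proof -
  have "(\<Sum>w\<in>UNIV. Q 1 x w) = 0" using Q_orth[of 1 0 x u] by (simp add: Q_0)
  moreover have "(\<Sum>w\<in>UNIV. Q 1 x w * Q 4 u w) = 0" using Q_orth[of 1 4 x u] by simp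
  ultimately show ?thesis using sum_fib[of "Q 1 x" u] by simp
qed

lemma sum_fib_2: "6 * (\<Sum>w\<in>fib u. Q 1 x w * Q 1 y w) = n * Q 1 x y"
proof -
  have "q 1 1 4 = 0" by (rule tridiag) auto
  then have "(\<Sum>w\<in>UNIV. Q 1 x w * Q 1 y w * Q 4 u w) = 0"
    by (intro triple_product_vanishes) auto
  then show ?thesis
    using sum_fib[of "\<lambda>w. Q 1 x w * Q 1 y w" u] Q_orth[of 1 1 x y] by simp
qed

text \<open>The right-hand side does not involve \<open>u\<close>: since \<open>Q 3\<close> is the product of \<open>Q 1\<close> and
  \<open>Q 4\<close>, this expresses the vanishing of the Krein parameter \<open>q 1 1 3\<close>, transported to an
  arbitrary fibre by means of the tight frame identity of the preceding lemma.\<close>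

lemma sum_fib_3:
  "6 * (\<Sum>w\<in>fib u. Q 1 x w * Q 1 y w * Q 1 z w) = (\<Sum>w\<in>UNIV. Q 1 x w * Q 1 y w * Q 1 z w)"
proof -
  have "q 1 1 3 = 0" by (rule tridiag) auto
  then have van: "(\<Sum>w\<in>UNIV. Q 1 x w * Q 1 y w * Q 3 v w) = 0" for v
    by (intro triple_product_vanishes) auto
  \<comment> \<open>The frame identity \<open>sum_fib_2\<close> expands \<open>n * Q 1 z w\<close>
    over \<open>v\<close> in the fibre of \<open>u\<close>. There \<open>Q 4 u w = Q 4 v w\<close>,
    so \<open>Q 1 w v\<close> and \<open>Q 4 u w\<close> combine into
    \<open>Q 3 v w\<close>.\<close>
  have "n * (\<Sum>w\<in>UNIV. Q 1 x w * Q 1 y w * Q 1 z w * Q 4 u w)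
      = (\<Sum>w\<in>UNIV. Q 1 x w * Q 1 y w * Q 4 u w * (n * Q 1 z w))"
    by (simp add: sum_distrib_left mult_ac)
  also have "\<dots> = (\<Sum>w\<in>UNIV. \<Sum>v\<in>fib u. 6 * Q 1 z v * (Q 1 x w * Q 1 y w * Q 3 v w))"
  proof (rule sum.cong[OF refl])
    fix w
    have v: "Q 4 u w * Q 1 w v = Q 3 v w" if "v \<in> fib u" for v
      using entry_eqs(4)[of v w] Q4_fib[OF that, of w] Q_sym[of 4 w] Q_sym[of 1 w v]
      by (simp add: mult.commute)
    have "Q 1 x w * Q 1 y w * Q 4 u w * (n * Q 1 z w)
        = (\<Sum>v\<in>fib u. 6 * Q 1 z v * (Q 1 x w * Q 1 y w * (Q 4 u w * Q 1 w v)))"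
      unfolding sum_fib_2[of z w u, symmetric] by (simp add: sum_distrib_left mult_ac)
    then show "Q 1 x w * Q 1 y w * Q 4 u w * (n * Q 1 z w)
        = (\<Sum>v\<in>fib u. 6 * Q 1 z v * (Q 1 x w * Q 1 y w * Q 3 v w))"
      using v by simp
  qed
  also have "\<dots> = (\<Sum>v\<in>fib u. 6 * Q 1 z v * (\<Sum>w\<in>UNIV. Q 1 x w * Q 1 y w * Q 3 v w))"
    by (subst sum.swap) (simp only: sum_distrib_left)
  also have "\<dots> = 0" by (simp only: van) simp
  finally have "(\<Sum>w\<in>UNIV. Q 1 x w * Q 1 y w * Q 1 z w * Q 4 u w) = 0" using n_pos by simp
  then show ?thesis using sum_fib[of "\<lambda>w. Q 1 x w * Q 1 y w * Q 1 z w" u] by simp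
qed

section \<open>Moments of shifted entries over a fibre\<close>

lemma shifted_sum_fib_1: "6 * (\<Sum>w\<in>fib u. Q 1 x w - a) = - n * a"
  using sum_fib_1[of x u] card_fib[of u] by (simp add: sum_subtractf algebra_simps)

text \<open>The shifts used later are the midpoints 2 (distinct fibres) and -4 (same fibre) of the
  two values of \<open>Q 1\<close>, so that off the diagonal each shifted entry is \<open>r\<close>
  times a sign.\<close>

lemma shifted_sum_fib_2: "6 * (\<Sum>w\<in>fib u. (Q 1 x w - a) * (Q 1 y w - b)) = n * (Q 1 x y + a * b)"
proof -
  have "(\<Sum>w\<in>fib u. (Q 1 x w - a) * (Q 1 y w - b))
      = (\<Sum>w\<in>fib u. Q 1 x w * Q 1 y w) - b * (\<Sum>w\<in>fib u. Q 1 x w) - a * (\<Sum>w\<in>fib u. Q 1 y w)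
        + a * b * card (fib u)"
    by (simp add: algebra_simps sum.distrib sum_subtractf sum_distrib_left)
  then show ?thesis
    using sum_fib_2[of x y u] card_fib[of u] unfolding sum_fib_1 by algebra
qed

lemma shifted_sum_fib_3:
  "6 * (\<Sum>w\<in>fib u. (Q 1 x w - a) * (Q 1 y w - b) * (Q 1 z w - c))
    = (\<Sum>w\<in>UNIV. Q 1 x w * Q 1 y w * Q 1 z w)
      - n * (c * Q 1 x y + b * Q 1 x z + a * Q 1 y z + a * b * c)"
proof -
  have "(\<Sum>w\<in>fib u. (Q 1 x w - a) * (Q 1 y w - b) * (Q 1 z w - c))
      = (\<Sum>w\<in>fib u. Q 1 x w * Q 1 y w * Q 1 z w)
        - c * (\<Sum>w\<in>fib u. Q 1 x w * Q 1 y w) - b * (\<Sum>w\<in>fib u. Q 1 x w * Q 1 z w)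
        - a * (\<Sum>w\<in>fib u. Q 1 y w * Q 1 z w)
        + b * c * (\<Sum>w\<in>fib u. Q 1 x w) + a * c * (\<Sum>w\<in>fib u. Q 1 y w)
        + a * b * (\<Sum>w\<in>fib u. Q 1 z w) - a * b * c * card (fib u)"
    by (simp add: algebra_simps sum.distrib sum_subtractf sum_distrib_left)
  then show ?thesis
    using sum_fib_2[of x y u] sum_fib_2[of x z u] sum_fib_2[of y z u] sum_fib_3[of x y z u]
      card_fib[of u]
    unfolding sum_fib_1 by algebra
qed

text \<open>Each fibre holds a sixth of all points, so three fibres never cover
  \<open>X\<close>.\<close>

lemma exists_four_fibres:
  obtains x y z u where "Q 4 x y = -1" "Q 4 x z = -1" "Q 4 y z = -1"
    "Q 4 x u = -1" "Q 4 y u = -1" "Q 4 z u = -1"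
proof -
  have new: "\<exists>u. \<forall>x\<in>set xs. Q 4 x u = -1" if "length xs \<le> 3" for xs
  proof (rule ccontr)
    assume "\<nexists>u. \<forall>x\<in>set xs. Q 4 x u = -1"
    then have "(\<Union>x\<in>set xs. fib x) = UNIV" using Q4_cases by (fastforce simp: fib_def)
    then have "CARD('a) \<le> (\<Sum>x\<in>set xs. card (fib x))"
      using card_UN_le[of "set xs" fib] by simp
    then have "n \<le> real (\<Sum>x\<in>set xs. card (fib x))"
      unfolding n_card by (simp only: of_nat_le_iff)
    also have "\<dots> = card (set xs) * (n / 6)"
    proof -
      have c: "real (card (fib x)) = n / 6" for x using card_fib[of x] by simp
      show ?thesis unfolding of_nat_sum c by simp
    qed
    also have "\<dots> \<le> 3 * (n / 6)"
      using that card_length[of xs] n_pos by (intro mult_right_mono) auto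
    finally show False using n_pos by simp
  qed
  fix x :: 'a
  obtain y where y: "Q 4 x y = -1" using new[of "[x]"] by auto
  obtain z where z: "Q 4 x z = -1" "Q 4 y z = -1" using new[of "[x, y]"] by auto
  obtain u where u: "Q 4 x u = -1" "Q 4 y u = -1" "Q 4 z u = -1" using new[of "[x, y, z]"] by auto
  show thesis using that y z u by blast
qed

section \<open>Sums of products of signs over a fibre\<close>

lemma eps_sum_outside_1:
  assumes "Q 4 x u = -1"
  shows "r * of_int (\<Sum>w\<in>fib u. eps x w) = - n / 3"
proof -
  have "r * of_int (\<Sum>w\<in>fib u. eps x w) = (\<Sum>w\<in>fib u. Q 1 x w - 2)"
    using assms Q4_fib[of _ u x] by (simp add: Q1_eps_outside sum_distrib_left del: One_nat_def)
  then show ?thesis using shifted_sum_fib_1[of x 2 u] by simp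
qed

lemma eps_sum_outside_2:
  assumes "Q 4 x u = -1" "Q 4 y u = -1"
  shows "6 * r\<^sup>2 * of_int (\<Sum>w\<in>fib u. eps x w * eps y w) = n * (Q 1 x y + 4)"
proof -
  have "r\<^sup>2 * of_int (\<Sum>w\<in>fib u. eps x w * eps y w)
      = (\<Sum>w\<in>fib u. (Q 1 x w - 2) * (Q 1 y w - 2))"
    using assms Q4_fib[of _ u x] Q4_fib[of _ u y]
    by (simp add: Q1_eps_outside sum_distrib_left power2_eq_square mult_ac del: One_nat_def)
  then show ?thesis using shifted_sum_fib_2[where u = u and x = x and y = y and a = 2 and b = 2]
    by simp
qed

text \<open>The sum over all points stays unevaluated: it recurs in \<open>eps_sum_inside_3\<close>
  and cancels in the comparison.\<close>

lemma eps_sum_outside_3: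
  assumes "Q 4 x u = -1" "Q 4 y u = -1" "Q 4 z u = -1"
  shows "6 * r ^ 3 * of_int (\<Sum>w\<in>fib u. eps x w * eps y w * eps z w)
    = (\<Sum>w\<in>UNIV. Q 1 x w * Q 1 y w * Q 1 z w) - 2 * n * (Q 1 x y + Q 1 x z + Q 1 y z + 4)"
proof -
  have "r ^ 3 * of_int (\<Sum>w\<in>fib u. eps x w * eps y w * eps z w)
      = (\<Sum>w\<in>fib u. (Q 1 x w - 2) * (Q 1 y w - 2) * (Q 1 z w - 2))"
    using assms Q4_fib[of _ u x] Q4_fib[of _ u y] Q4_fib[of _ u z]
    by (simp add: Q1_eps_outside sum_distrib_left power3_eq_cube mult_ac del: One_nat_def)
  then show ?thesis
    using shifted_sum_fib_3[where u = u and x = x and y = y and z = z and a = 2 and b = 2 and c = 2]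
    by (simp add: algebra_simps)
qed

text \<open>In the fibre of \<open>x\<close> itself the shift for \<open>x\<close> is -4. The point
  \<open>w = x\<close> is split off because \<open>Q 1 x x + 4\<close> equals
  \<open>r\<^sup>2\<close>, not \<open>r\<close> times a sign; this is the extra term with factor
  \<open>r\<close>.\<close>

lemma eps_sum_inside_3:
  assumes "Q 4 y x = -1" "Q 4 z x = -1"
  shows "6 * r ^ 3 * (of_int (\<Sum>w\<in>fib x - {x}. eps x w * eps y w * eps z w)
        + r * of_int (eps y x * eps z x))
    = (\<Sum>w\<in>UNIV. Q 1 x w * Q 1 y w * Q 1 z w)
      - 2 * n * (Q 1 x y + Q 1 x z - 2 * Q 1 y z - 8)"
proof -
  let ?f = "\<lambda>w. (Q 1 x w + 4) * (Q 1 y w - 2) * (Q 1 z w - 2)"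
  have "x \<in> fib x" by (simp add: fib_def Q_diag m_eqs)
  then have "(\<Sum>w\<in>fib x. ?f w) = ?f x + (\<Sum>w\<in>fib x - {x}. ?f w)"
    by (intro sum.remove) auto
  moreover have "?f x = r ^ 4 * of_int (eps y x * eps z x)"
  proof -
    have "Q 1 x x + 4 = r\<^sup>2" using Q_diag[of 1 x] m_eqs(2) by simp
    then show ?thesis using Q1_eps_outside assms
      by (simp add: power2_eq_square power4_eq_xxxx)
  qed
  moreover have "(\<Sum>w\<in>fib x - {x}. ?f w)
      = (\<Sum>w\<in>fib x - {x}. r ^ 3 * of_int (eps x w * eps y w * eps z w))"
  proof (rule sum.cong[OF refl])
    fix w assume w: "w \<in> fib x - {x}"
    then have "Q 1 x w = -4 + r * eps x w" by (intro Q1_eps_inside) (auto simp: fib_def)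
    moreover have "Q 1 y w = 2 + r * eps y w" "Q 1 z w = 2 + r * eps z w"
      by (rule Q1_eps_outside, use w assms Q4_fib[of w x] in simp)+
    ultimately show "?f w = r ^ 3 * of_int (eps x w * eps y w * eps z w)"
      by (simp add: power3_eq_cube)
  qed
  ultimately have "(\<Sum>w\<in>fib x. ?f w)
      = r ^ 3 * (of_int (\<Sum>w\<in>fib x - {x}. eps x w * eps y w * eps z w)
        + r * of_int (eps y x * eps z x))"
    by (simp add: sum_distrib_left algebra_simps power3_eq_cube power4_eq_xxxx)
  then show ?thesis
    using shifted_sum_fib_3[where u = x and x = x and y = y and z = z and a = "-4" and b = 2 and c = 2]
    by (simp add: algebra_simps)
qed

section \<open>Integrality of \<open>r\<close> and the contradiction\<close>

lemma r_integer: "r \<in> \<int>"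
proof -
  obtain x u where "Q 4 x u = -1" using exists_four_fibres by metis
  define A where "A = (\<Sum>w\<in>fib u. eps x w)"
  have A: "r * of_int A = - n / 3" unfolding A_def by (rule eps_sum_outside_1) fact
  then have "of_int A \<noteq> (0::real)" using n_pos by auto
  then have "r = (- n / 3) / of_int A" using A by (simp add: field_simps)
  then have "r \<in> \<rat>" by (simp add: n_card)
  \<comment> \<open>Inserting the value of \<open>n\<close> makes \<open>r\<close> a root of a monic
    cubic with integer coefficients; a rational algebraic integer is an integer.\<close>
  moreover have "r * (r ^ 3 - r + 6 * of_int A) = 0"
    using A n_eq by (simp add: algebra_simps power2_eq_square power3_eq_cube)
  then have "r ^ 3 - r + 6 * of_int A = 0" using r_pos by simp
  then have "algebraic_int r"
    by (intro algebraic_int.intros[of "[:6 * of_int A, -1, 0, 1:]"])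
      (auto simp: coeff_pCons algebra_simps power3_eq_cube split: nat.splits)
  ultimately show ?thesis using rational_algebraic_int_is_int by blast
qed

lemma inconsistent: False
proof -
  obtain k where k: "r = of_int k" using r_integer by (elim Ints_cases)
  then have k3: "k > 3" using r_gt_3 by simp
  obtain x y z u where Q4: "Q 4 x y = -1" "Q 4 x z = -1" "Q 4 y z = -1"
    "Q 4 x u = -1" "Q 4 y u = -1" "Q 4 z u = -1" by (rule exists_four_fibres)
  then have Q4': "Q 4 y x = -1" "Q 4 z x = -1" using Q_sym[of 4] by simp_all
  define e where "e = eps y z"
  have e: "Q 1 y z = 2 + r * of_int e" unfolding e_def by (rule Q1_eps_outside) fact
  define S where "S = (\<Sum>w\<in>fib u. eps x w * eps y w * eps z w)"
  define S' where "S' = (\<Sum>w\<in>fib x - {x}. eps x w * eps y w * eps z w)"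
  define d where "d = eps y x * eps z x"
  \<comment> \<open>Subtracting the two third-moment formulas cancels the full sum and the entries
    \<open>Q 1 x y\<close> and \<open>Q 1 x z\<close>; what remains is
    \<open>6 * n * (Q 1 y z + 4)\<close>.\<close>
  have "6 * r ^ 3 * (of_int S' + r * of_int d) - 6 * r ^ 3 * of_int S = 6 * n * (6 + r * of_int e)"
    unfolding S_def S'_def d_def eps_sum_outside_3[OF Q4(4-6)] eps_sum_inside_3[OF Q4'] e
    by (simp add: algebra_simps)
  then have "r\<^sup>2 * (2 * r * (of_int S' + r * of_int d - of_int S))
      = r\<^sup>2 * ((r\<^sup>2 - 1) * (6 + r * of_int e))"
    using n_eq by algebra
  then have "2 * r * (of_int S' + r * of_int d - of_int S) = (r\<^sup>2 - 1) * (6 + r * of_int e)"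
    using r_pos by simp
  then have "of_int (2 * k * (S' + k * d - S)) = (of_int ((k\<^sup>2 - 1) * (6 + k * e)) :: real)"
    by (simp add: k)
  then have "2 * k * (S' + k * d - S) = (k\<^sup>2 - 1) * (6 + k * e)" by (simp only: of_int_eq_iff)
  \<comment> \<open>Modulo \<open>k\<close> the right side of the preceding equation is -6 and the
    left side is 0.\<close>
  then have "6 = k * (6 * k + (k\<^sup>2 - 1) * e - 2 * (S' + k * d - S))" by algebra
  then have "k dvd 6" by (metis dvd_triv_left)
  then have "k \<le> 6" by (simp add: zdvd_imp_le)
  then have "k = 4 \<or> k = 5 \<or> k = 6" using k3 by auto
  then have "k = 6" using \<open>k dvd 6\<close> by auto
  then have r6: "r = 6" using k by simp
  then have n630: "n = 630" using n_eq by simp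
  have A: "(\<Sum>w\<in>fib u. eps v w) = -35" if "Q 4 v u = -1" for v
  proof -
    have "real_of_int (\<Sum>w\<in>fib u. eps v w) = of_int (-35)"
      using eps_sum_outside_1[OF that] unfolding r6 n630 by simp
    then show ?thesis by (simp only: of_int_eq_iff)
  qed
  have "card (fib u) = 105" using card_fib[of u] n630 by simp
  \<comment> \<open>Each summand is 4 at a common positive neighbour of \<open>y\<close> and
    \<open>z\<close> and 0 elsewhere. The constant is 105 - 35 - 35 = 35, so the sum is 70 for
    \<open>e = 1\<close> and 35 for \<open>e = -1\<close>, neither divisible by 4.\<close>
  then have "(\<Sum>w\<in>fib u. (1 + eps y w) * (1 + eps z w))
      = 35 + (\<Sum>w\<in>fib u. eps y w * eps z w)"
    using A[OF Q4(5)] A[OF Q4(6)] by (simp add: algebra_simps sum.distrib)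
  moreover have "2 * (\<Sum>w\<in>fib u. eps y w * eps z w) = 35 * (1 + e)"
  proof -
    have "real_of_int (2 * (\<Sum>w\<in>fib u. eps y w * eps z w)) = of_int (35 * (1 + e))"
      using eps_sum_outside_2[OF Q4(5,6)] unfolding r6 n630 e by simp
    then show ?thesis by (simp only: of_int_eq_iff)
  qed
  moreover have "4 dvd (\<Sum>w\<in>fib u. (1 + eps y w) * (1 + eps z w))"
  proof (rule dvd_sum)
    fix w show "4 dvd (1 + eps y w) * (1 + eps z w)"
      using eps_cases[of y w] eps_cases[of z w] by auto
  qed
  moreover have False
    if "s = 35 + p" "2 * p = 35 * (1 + e)" "4 dvd s" "e = 1 \<or> e = -1" for s p e :: int
    using that by presburger
  ultimately show False using eps_cases[of y z] unfolding e_def by blast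
qed

end

section \<open>Passage from the scheme to the entrywise system\<close>

lemma krein_system_of_scheme:
  fixes R :: "nat \<Rightarrow> ('a::finite) rel"
  assumes "association_scheme D R" and "idempotent_ordering D R E" and "krein_parameters D E q"
  shows "krein_system D (\<lambda>i x y. real CARD('a) * E i $ x $ y) q
    (\<lambda>i. real CARD('a) * E i $ undefined $ undefined) (real CARD('a))"
proof
  let ?n = "real CARD('a)"
  fix i j x y
  show "?n = ?n" ..
  show sym: "?n * E i $ x $ y = ?n * E i $ y $ x" if "i \<le> D" for i x y
    using symmetric_bose_mesner[OF assms(1) idempotent_ordering_in[OF assms(1,2) that]]
    by (metis (mono_tags, lifting) transpose_def vec_lambda_beta)
  show "(\<Sum>w\<in>UNIV. ?n * E i $ x $ w * (?n * E j $ y $ w))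
      = (if i = j then ?n * (?n * E i $ x $ y) else 0)" if "i \<le> D" "j \<le> D"
  proof -
    have "(\<Sum>w\<in>UNIV. ?n * E i $ x $ w * (?n * E j $ y $ w))
        = (\<Sum>w\<in>UNIV. ?n * E i $ x $ w * (?n * E j $ w $ y))"
      using sym[OF that(2)] by simp
    also have "\<dots> = ?n * (?n * (E i ** E j) $ x $ y)"
      by (simp add: matrix_matrix_mult_def sum_distrib_left mult_ac)
    finally show ?thesis using idempotent_ordering_mult[OF assms(1,2) that] by simp
  qed
  show "?n * E 0 $ x $ y = 1"
    using assms(2) by (simp add: idempotent_ordering_def all_ones_def)
  show "(\<Sum>i\<le>D. ?n * E i $ x $ y) = (if x = y then ?n else 0)"
  proof -
    have "(\<Sum>i\<le>D. E i) $ x $ y = mat 1 $ x $ y"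
      using idempotent_ordering_sum[OF assms(1,2)] by simp
    then have "(\<Sum>i\<le>D. E i $ x $ y) = (if x = y then 1 else 0)" by (simp add: mat_def)
    then show ?thesis by (simp add: sum_distrib_left[symmetric])
  qed
  \<comment> \<open>The point \<open>undefined\<close> is an arbitrary reference point: matrices in
    the algebra have constant diagonal.\<close>
  show "?n * E i $ x $ x = ?n * E i $ undefined $ undefined" if "i \<le> D"
    using diag_bose_mesner[OF assms(1) idempotent_ordering_in[OF assms(1,2) that], of x undefined]
    by simp
  show "\<exists>x y. ?n * E i $ x $ y \<noteq> 0" if "i \<le> D"
    using idempotent_ordering_nonzero[OF assms(1,2) that] by (auto simp: vec_eq_iff)
  show "?n * E i $ x $ y * (?n * E j $ x $ y) = (\<Sum>k\<le>D. q i j k * (?n * E k $ x $ y))"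
    if "i \<le> D" "j \<le> D"
  proof -
    have "E i * E j = (1 / ?n) *\<^sub>R (\<Sum>k\<le>D. q i j k *\<^sub>R E k)"
      using assms(3) that by (simp add: krein_parameters_def)
    then have "(E i * E j) $ x $ y = ((1 / ?n) *\<^sub>R (\<Sum>k\<le>D. q i j k *\<^sub>R E k)) $ x $ y" by simp
    then have "E i $ x $ y * E j $ x $ y = (\<Sum>k\<le>D. q i j k * E k $ x $ y) / ?n" by simp
    then have "?n * (E i $ x $ y * E j $ x $ y) = (\<Sum>k\<le>D. q i j k * E k $ x $ y)" by simp
    then have "?n * (?n * (E i $ x $ y * E j $ x $ y)) = ?n * (\<Sum>k\<le>D. q i j k * E k $ x $ y)"
      by simp
    then show ?thesis by (simp add: sum_distrib_left mult_ac)
  qed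
qed

theorem theorem4p1:
  fixes r :: real
    and R :: "nat \<Rightarrow> ('a::finite) rel"
    and E :: "nat \<Rightarrow> real^'a^'a"
    and q :: "nat \<Rightarrow> nat \<Rightarrow> nat \<Rightarrow> real"
  assumes "r > 0"
    and "association_scheme 4 R"
    and "idempotent_ordering 4 R E"
    and "krein_parameters 4 E q"
    and "Q_polynomial 4 q"
    and "krein_array 4 q =
      ([r\<^sup>2 - 4, r\<^sup>2 - 9, 10, 1], [1, 2, r\<^sup>2 - 9, r\<^sup>2 - 4])"
  shows "r = 9"
proof -
  interpret krein_system 4 "\<lambda>i x y. real CARD('a) * E i $ x $ y" q
    "\<lambda>i. real CARD('a) * E i $ undefined $ undefined" "real CARD('a)"
    by (rule krein_system_of_scheme) fact+
  have arr: "q 1 1 0 = r\<^sup>2 - 4" "q 1 2 1 = r\<^sup>2 - 9" "q 1 3 2 = 10" "q 1 4 3 = 1"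
    "q 1 0 1 = 1" "q 1 1 2 = 2" "q 1 2 3 = r\<^sup>2 - 9" "q 1 3 4 = r\<^sup>2 - 4"
    using assms(6) by (simp_all add: krein_array_def upt_rec numeral_eq_Suc)
  \<comment> \<open>This off-diagonal entry is \<open>r\<^sup>2 - 9\<close>, so its nonvanishing
    supplies \<open>b1_nonzero\<close>.\<close>
  have "q 1 2 1 \<noteq> 0" using assms(5)[unfolded Q_polynomial_def, rule_format, of 1 2] by simp
  interpret krein_array_r "\<lambda>i x y. real CARD('a) * E i $ x $ y" q
    "\<lambda>i. real CARD('a) * E i $ undefined $ undefined" "real CARD('a)" r
  proof
    show "q 1 j k = 0" if "j \<le> 4" "k \<le> 4" "j + 1 < k \<or> k + 1 < j" for j k
      using assms(5) that unfolding Q_polynomial_def by blast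
    show "r\<^sup>2 \<noteq> 9" using \<open>q 1 2 1 \<noteq> 0\<close> arr(2) by simp
  qed (use assms(1) arr in simp_all)
  show ?thesis using inconsistent by blast
qed

end
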